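(* Let $(\mathcal{Z},\mathfrak{Z})$ be a measurable space, $P$ a probability measure on it, $\alpha>0$, $r>1$, and let $\ell:\mathcal{Z}\to(-\infty,\infty]$ be measurable, $\ell\in\mathcal{L}^1(P)$, and bounded below $P$-almost surely. Put $s=1/(r-1)$ and, for $\lambda>\operatorname{ess\,inf}_P\ell$ and $t>0$, $A_t(\lambda)=\int_{\mathcal{Z}}(\lambda-\ell)_+^t\,\mathrm{d}P$. Let $u^\star$ be a global minimizer of $$\inf_{u\ge 0,\ \int_{\mathcal{Z}}u\,\mathrm{d}P=1}\left\{\int_{\mathcal{Z}}\ell u\,\mathrm{d}P+\frac{\alpha}{r-1}\log\int_{\mathcal{Z}}u^r\,\mathrm{d}P\right\}$$ (over measurable $u$), and let $Q^\star$ be the probability measure with $\mathrm{d}Q^\star/\mathrm{d}P=u^\star$. If $0<\int_{\mathcal{Z}}(u^\star)^r\,\mathrm{d}P<\infty$, then there exists $\lambda^\star>\operatorname{ess\,inf}_P\ell$ such that $$\frac{\mathrm{d}Q^\star}{\mathrm{d}P}(z)=u^\star(z)=\frac{(\lambda^\star-\ell(z))_+^s}{A_s(\lambda^\star)}\quad\text{for }P\text{-a.e. }z,$$ and $\lambda^\star$ satisfies $$\alpha=\frac{r-1}{r}\,\frac{A_{s+1}(\lambda^\star)}{A_s(\lambda^\star)}.$$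
   Context: $a_+=\max\{a,0\}$ (with $(\lambda-\ell(z))_+=0$ where $\ell(z)=\infty$). The quantity $\frac{1}{r-1}\log\int_{\mathcal{Z}}u^r\,\mathrm{d}P$ with $u=\mathrm{d}Q/\mathrm{d}P$ is the Rényi divergence of order $r$ of $Q$ from $P$; it is $+\infty$ if $\int u^r\,\mathrm{d}P=\infty$. Integrals are extended integrals in $(-\infty,\infty]$, defined whenever the negative part of the integrand has finite integral. Since $\ell$ is bounded below, $A_t(\lambda)<\infty$ for all finite $\lambda$ and $t>0$. *)

theory Defs
  imports "HOL-Probability.Probability"
begin

text \<open>Extended integral of an extended-real function. The function \<^const>\<open>e2ennreal\<close> sends
  negative values to 0, so the two integrals are those of the positive and the negative part.
  The value is meaningful only if the negative part has finite integral.\<close>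

definition ext_integral :: "'a measure \<Rightarrow> ('a \<Rightarrow> ereal) \<Rightarrow> ereal" where
  "ext_integral M f =
     enn2ereal (\<integral>\<^sup>+ z. e2ennreal (f z) \<partial>M) - enn2ereal (\<integral>\<^sup>+ z. e2ennreal (- f z) \<partial>M)"

definition ext_L1 :: "'a measure \<Rightarrow> ('a \<Rightarrow> ereal) \<Rightarrow> bool" where
  "ext_L1 M f \<longleftrightarrow> f \<in> borel_measurable M \<and> (\<integral>\<^sup>+ z. e2ennreal \<bar>f z\<bar> \<partial>M) < \<infinity>"

definition ess_inf :: "'a measure \<Rightarrow> ('a \<Rightarrow> ereal) \<Rightarrow> ereal" where
  "ess_inf M f = - esssup M (\<lambda>z. - f z)"

definition ext_log :: "ennreal \<Rightarrow> ereal" where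
  "ext_log x = (if x = 0 then -\<infinity> else if x = \<infinity> then \<infinity> else ereal (ln (enn2real x)))"

definition density_fun :: "'a measure \<Rightarrow> ('a \<Rightarrow> real) \<Rightarrow> bool" where
  "density_fun P u \<longleftrightarrow> u \<in> borel_measurable P \<and> (\<forall>z\<in>space P. 0 \<le> u z)
     \<and> (\<integral>\<^sup>+ z. ennreal (u z) \<partial>P) = 1"

definition objective :: "'a measure \<Rightarrow> real \<Rightarrow> real \<Rightarrow> ('a \<Rightarrow> ereal) \<Rightarrow> ('a \<Rightarrow> real) \<Rightarrow> ereal" where
  "objective P \<alpha> r l u =
     ext_integral P (\<lambda>z. l z * ereal (u z))
     + ereal (\<alpha> / (r - 1)) * ext_log (\<integral>\<^sup>+ z. ennreal (u z powr r) \<partial>P)"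

text \<open>The positive part of \<open>lam - l z\<close>; it is 0 where \<open>l z = \<infinity>\<close>, because then
  \<open>ereal lam - l z = -\<infinity>\<close>.\<close>

definition pos_gap :: "('a \<Rightarrow> ereal) \<Rightarrow> real \<Rightarrow> 'a \<Rightarrow> real" where
  "pos_gap l lam z = real_of_ereal (max 0 (ereal lam - l z))"

text \<open>If \<open>l\<close> is measurable and bounded below almost surely, the integrand is bounded almost surely
  for \<open>t > 0\<close>, so a real-valued integral suffices.\<close>

definition A_fun :: "'a measure \<Rightarrow> ('a \<Rightarrow> ereal) \<Rightarrow> real \<Rightarrow> real \<Rightarrow> real" where
  "A_fun P l t lam = (\<integral> z. pos_gap l lam z powr t \<partial>P)"

end

theory Submission
  imports Defs
begin

text \<open>Perturbing the minimizer \<open>u\<close> towards an indicator density \<open>1_B / P(B)\<close> gives a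
  first-order condition on \<open>w = l + k u^(r-1)\<close>, where \<open>k = \<alpha> r / ((r-1) \<integral> u^r)\<close>: with
  \<open>\<lambda> = \<integral> w u\<close>, the average of \<open>w\<close> over \<open>B\<close> is at least \<open>\<lambda>\<close>. So \<open>w \<ge> \<lambda>\<close> almost everywhere, with
  equality where \<open>u > 0\<close>, that is, \<open>k u^(r-1) = (\<lambda> - l)_+\<close>. Integrating \<open>u\<close> and \<open>u^r\<close> then
  determines \<open>A_s(\<lambda>) = k^s\<close> and \<open>A_(s+1)(\<lambda>) = k^(s+1) \<integral> u^r\<close>.\<close>

section \<open>Elementary inequalities for real powers\<close>

text \<open>This is the tangent inequality for the convex function \<open>t powr r\<close> at
  \<open>x\<close>. Young's inequality with the conjugate exponents \<open>r / (r - 1)\<close> and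
  \<open>r\<close>, applied to \<open>x powr (r - 1)\<close> and \<open>y\<close>, gives it without
  derivatives and covers the boundary value 0.\<close>

lemma powr_tangent_le:
  fixes x y r :: real
  assumes "1 < r" "0 \<le> x" "0 \<le> y"
  shows "x powr r - y powr r \<le> r * (x powr (r - 1) * (x - y))"
proof -
  have pr: "(x powr (r - 1)) powr (r / (r - 1)) = x powr r"
    using assms by (simp add: powr_powr)
  have "x powr (r - 1) * y \<le> x powr r / (r / (r - 1)) + y powr r / r"
    using Youngs_inequality[of "r / (r - 1)" r "x powr (r - 1)" y] assms pr
    by (simp add: field_simps)
  then have "r * (x powr (r - 1) * y) \<le> r * (x powr r / (r / (r - 1)) + y powr r / r)"
    using assms by (intro mult_left_mono) auto
  also have "\<dots> = (r - 1) * x powr r + y powr r"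
    using assms by (simp add: field_simps)
  finally have "r * (x powr (r - 1) * y) \<le> (r - 1) * x powr r + y powr r" .
  moreover have "x powr (r - 1) * x = x powr r"
    using powr_mult_base[of x "r - 1"] assms by (simp add: mult.commute)
  ultimately show ?thesis
    by (simp add: algebra_simps)
qed

lemma convex_mix_le_max:
  fixes a b e :: real
  assumes "0 \<le> e" "e \<le> 1"
  shows "(1 - e) * a + e * b \<le> max a b"
  using convex_bound_le[of a "max a b" b "1 - e" e] assms by simp

text \<open>A convex combination is at most the larger endpoint. The bound is free of
  \<open>e\<close> and makes the \<open>r\<close>-th power of a mixture of two densities
  integrable.\<close>

lemma powr_mix_le:
  fixes a b e r :: real
  assumes "0 \<le> e" "e \<le> 1" "0 \<le> a" "0 \<le> b" "0 \<le> r"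
  shows "((1 - e) * a + e * b) powr r \<le> a powr r + b powr r"
proof -
  have "((1 - e) * a + e * b) powr r \<le> (max a b) powr r"
    using assms by (intro powr_mono2 convex_mix_le_max) auto
  also have "\<dots> \<le> a powr r + b powr r"
    by (simp add: max_def)
  finally show ?thesis .
qed

text \<open>Both factors are controlled by \<open>max a b\<close>, for a total power
  \<open>r\<close>. Being free of \<open>e\<close>, the bound serves as the dominating function when
  \<open>e\<close> tends to 0.\<close>

lemma powr_mix_diff_le:
  fixes a b e r :: real
  assumes "0 \<le> e" "e \<le> 1" "0 \<le> a" "0 \<le> b" "1 < r"
  shows "\<bar>((1 - e) * a + e * b) powr (r - 1) * (b - a)\<bar> \<le> a powr r + b powr r"
proof -
  have "\<bar>((1 - e) * a + e * b) powr (r - 1) * (b - a)\<bar> \<le> max a b powr (r - 1) * max a b"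
    unfolding abs_mult
  proof (rule mult_mono)
    show "\<bar>((1 - e) * a + e * b) powr (r - 1)\<bar> \<le> max a b powr (r - 1)"
      unfolding abs_of_nonneg[OF powr_ge_zero] using assms
      by (intro powr_mono2 convex_mix_le_max) auto
  qed (use assms in auto)
  also have "\<dots> = max a b powr r"
    using powr_mult_base[of "max a b" "r - 1"] assms by (simp add: mult.commute)
  also have "\<dots> \<le> a powr r + b powr r"
    by (simp add: max_def)
  finally show ?thesis .
qed

section \<open>Densities and the real-valued form of the objective\<close>

lemma density_fun_integral:
  assumes "density_fun M u"
  shows "integrable M u" "integral\<^sup>L M u = 1"
proof -
  have u: "u \<in> borel_measurable M" "AE z in M. 0 \<le> u z" "(\<integral>\<^sup>+ z. ennreal (u z) \<partial>M) = ennreal 1"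
    using assms by (auto simp: density_fun_def)
  show "integrable M u" using u by (intro integrableI_nn_integral_finite)
  show "integral\<^sup>L M u = 1" using u by (subst integral_eq_nn_integral) auto
qed

lemma density_funI:
  assumes "integrable M u" "\<And>z. z \<in> space M \<Longrightarrow> 0 \<le> u z" "integral\<^sup>L M u = 1"
  shows "density_fun M u"
  using assms by (auto simp: density_fun_def nn_integral_eq_integral)

lemma density_fun_mix:
  assumes "density_fun M u" "density_fun M v" "0 \<le> e" "e \<le> 1"
  shows "density_fun M (\<lambda>z. (1 - e) * u z + e * v z)"
proof (rule density_funI)
  note [simp] = density_fun_integral[OF assms(1)] density_fun_integral[OF assms(2)]
  show "integrable M (\<lambda>z. (1 - e) * u z + e * v z)" by simp
  show "(\<integral>z. (1 - e) * u z + e * v z \<partial>M) = 1" by simp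
  show "0 \<le> (1 - e) * u z + e * v z" if "z \<in> space M" for z
    using assms that by (auto simp: density_fun_def)
qed

text \<open>If the integral vanished, so would \<open>u\<close> almost everywhere, against its unit
  mass. Positivity puts \<open>ext_log\<close> in its real branch and allows division by the
  integral.\<close>

lemma density_fun_powr_integral_pos:
  assumes "density_fun M u" "integrable M (\<lambda>z. u z powr r)"
  shows "0 < (\<integral>z. u z powr r \<partial>M)"
proof (rule ccontr)
  assume "\<not> 0 < (\<integral>z. u z powr r \<partial>M)"
  moreover have "0 \<le> (\<integral>z. u z powr r \<partial>M)"
    by (rule integral_nonneg_AE) simp
  ultimately have "(\<integral>z. u z powr r \<partial>M) = 0"
    by linarith
  then have "AE z in M. u z powr r = 0"
    using assms(2) by (subst (asm) integral_nonneg_eq_0_iff_AE) auto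
  then have "AE z in M. u z = 0" by eventually_elim auto
  then have "integral\<^sup>L M u = 0" by (rule integral_eq_zero_AE)
  then show False using density_fun_integral[OF assms(1)] by simp
qed

lemma ext_integral_eq_integral:
  assumes "integrable M f" "AE z in M. g z = ereal (f z)"
  shows "ext_integral M g = ereal (integral\<^sup>L M f)"
proof -
  have "(\<integral>\<^sup>+ z. e2ennreal (g z) \<partial>M) = (\<integral>\<^sup>+ z. ennreal (f z) \<partial>M)"
    using assms(2) by (intro nn_integral_cong_AE) auto
  moreover have "(\<integral>\<^sup>+ z. e2ennreal (- g z) \<partial>M) = (\<integral>\<^sup>+ z. ennreal (- f z) \<partial>M)"
    using assms(2) by (intro nn_integral_cong_AE) auto
  moreover obtain p q where "0 \<le> p" "0 \<le> q" "(\<integral>\<^sup>+ z. ennreal (f z) \<partial>M) = ennreal p"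
     "(\<integral>\<^sup>+ z. ennreal (- f z) \<partial>M) = ennreal q" "integral\<^sup>L M f = p - q"
    by (rule integrableE[OF assms(1)]) auto
  ultimately show ?thesis by (simp add: ext_integral_def)
qed

text \<open>With every term finite, the extended objective becomes a real expression, whose
  increments can be subtracted and estimated.\<close>

lemma objective_eq:
  assumes "density_fun M u" "integrable M (\<lambda>z. u z powr r)" "integrable M (\<lambda>z. L z * u z)"
    and "AE z in M. l z = ereal (L z)"
  shows "objective M \<alpha> r l u
    = ereal ((\<integral>z. L z * u z \<partial>M) + \<alpha> / (r - 1) * ln (\<integral>z. u z powr r \<partial>M))"
proof -
  have "ext_integral M (\<lambda>z. l z * ereal (u z)) = ereal (\<integral>z. L z * u z \<partial>M)"
    using assms(4) by (intro ext_integral_eq_integral assms(3)) auto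
  moreover have "(\<integral>\<^sup>+ z. ennreal (u z powr r) \<partial>M) = ennreal (\<integral>z. u z powr r \<partial>M)"
    using assms(2) by (intro nn_integral_eq_integral) auto
  ultimately show ?thesis
    using density_fun_powr_integral_pos[OF assms(1,2)] by (simp add: objective_def ext_log_def)
qed

section \<open>First-order condition at the minimizer\<close>

text \<open>The functional need not be convex in \<open>u\<close>, but the tangent inequalities for \<open>x powr r\<close> (at the
  mixture) and for \<open>ln\<close> (at the minimizer) bound its increments by first-order terms.\<close>

lemma first_order_condition:
  assumes r: "1 < r" and \<alpha>: "0 < \<alpha>"
    and u: "density_fun M u" "integrable M (\<lambda>z. u z powr r)" "integrable M (\<lambda>z. L z * u z)"
    and v: "density_fun M v" "integrable M (\<lambda>z. v z powr r)" "integrable M (\<lambda>z. L z * v z)"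
    and L: "AE z in M. l z = ereal (L z)"
    and min: "\<And>w. density_fun M w \<Longrightarrow> objective M \<alpha> r l u \<le> objective M \<alpha> r l w"
  shows "0 \<le> (\<integral>z. L z * (v z - u z) \<partial>M)
    + \<alpha> * r / ((r - 1) * (\<integral>z. u z powr r \<partial>M)) * (\<integral>z. u z powr (r - 1) * (v z - u z) \<partial>M)"
proof -
  have [measurable]: "u \<in> borel_measurable M" "v \<in> borel_measurable M"
    using u(1) v(1) by (auto simp: density_fun_def)
  have nonneg: "0 \<le> u z" "0 \<le> v z" if "z \<in> space M" for z
    using u(1) v(1) that by (auto simp: density_fun_def)
  define S where "S = (\<integral>z. u z powr r \<partial>M)"
  have S: "0 < S" unfolding S_def using density_fun_powr_integral_pos u by blast
  \<comment> \<open>An upper bound on the increment of the \<open>r\<close>-th power needs the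
    tangent at the mixture, not at \<open>u\<close>. The slope \<open>D e\<close> therefore depends
    on \<open>e\<close>, and a limit remains to be taken.\<close>
  define D where "D e = (\<integral>z. ((1 - e) * u z + e * v z) powr (r - 1) * (v z - u z) \<partial>M)" for e
  define I where "I = (\<integral>z. L z * (v z - u z) \<partial>M)"
  have intuv: "integrable M (\<lambda>z. u z powr r + v z powr r)" using u v by simp
  have step: "0 \<le> I + \<alpha> * r / ((r - 1) * S) * D e" if e: "0 < e" "e \<le> 1" for e
  proof -
    define w where "w z = (1 - e) * u z + e * v z" for z
    have [measurable]: "w \<in> borel_measurable M" unfolding w_def by measurable
    have wd: "density_fun M w"
      unfolding w_def using density_fun_mix[OF u(1) v(1)] e by simp
    have w0: "0 \<le> w z" if "z \<in> space M" for z
      using wd that by (auto simp: density_fun_def)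
    have wr: "integrable M (\<lambda>z. w z powr r)"
    proof (rule Bochner_Integration.integrable_bound[OF intuv])
      have "w z powr r \<le> u z powr r + v z powr r" if "z \<in> space M" for z
        unfolding w_def using e r by (intro powr_mix_le nonneg that) auto
      then show "AE z in M. norm (w z powr r) \<le> norm (u z powr r + v z powr r)"
        by (intro AE_I2) simp
    qed measurable
    have Lw_eq: "L z * w z = (1 - e) * (L z * u z) + e * (L z * v z)" for z
      by (simp add: w_def algebra_simps)
    have wL: "integrable M (\<lambda>z. L z * w z)"
      unfolding Lw_eq using u v by simp
    have I_eq: "I = (\<integral>z. L z * v z \<partial>M) - (\<integral>z. L z * u z \<partial>M)"
      using u v by (simp add: I_def right_diff_distrib)
    have Lw: "(\<integral>z. L z * w z \<partial>M) - (\<integral>z. L z * u z \<partial>M) = e * I"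
      unfolding Lw_eq I_eq using u v by (simp add: algebra_simps)
    have Dint: "integrable M (\<lambda>z. w z powr (r - 1) * (v z - u z))"
    proof (rule Bochner_Integration.integrable_bound[OF intuv])
      have "\<bar>w z powr (r - 1) * (v z - u z)\<bar> \<le> u z powr r + v z powr r" if "z \<in> space M" for z
        unfolding w_def using e r by (intro powr_mix_diff_le nonneg that) auto
      then show "AE z in M. norm (w z powr (r - 1) * (v z - u z)) \<le> norm (u z powr r + v z powr r)"
        by (intro AE_I2) simp
    qed measurable
    have T: "0 < (\<integral>z. w z powr r \<partial>M)"
      by (rule density_fun_powr_integral_pos[OF wd wr])
    have "(\<integral>z. w z powr r \<partial>M) - S = (\<integral>z. w z powr r - u z powr r \<partial>M)"
      using wr u by (simp add: S_def)
    also have "\<dots> \<le> (\<integral>z. (e * r) * (w z powr (r - 1) * (v z - u z)) \<partial>M)"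
    proof (rule integral_mono)
      fix z assume z: "z \<in> space M"
      have "w z - u z = e * (v z - u z)" by (simp add: w_def algebra_simps)
      then show "w z powr r - u z powr r \<le> (e * r) * (w z powr (r - 1) * (v z - u z))"
        using powr_tangent_le[OF r w0[OF z] nonneg(1)[OF z]] by (simp add: mult.left_commute mult.assoc)
    qed (use wr u Dint in auto)
    also have "\<dots> = e * r * D e" by (simp add: D_def w_def)
    finally have pow: "(\<integral>z. w z powr r \<partial>M) - S \<le> e * r * D e" .
    \<comment> \<open>Concavity of \<open>ln\<close>: its graph lies below the tangent at
      \<open>S\<close>.\<close>
    have "ln (\<integral>z. w z powr r \<partial>M) - ln S \<le> ((\<integral>z. w z powr r \<partial>M) - S) / S"
      by (rule ln_diff_le[OF T S])
    also have "\<dots> \<le> e * r * D e / S"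
      using pow S by (intro divide_right_mono) auto
    finally have "\<alpha> / (r - 1) * (ln (\<integral>z. w z powr r \<partial>M) - ln S) \<le> \<alpha> / (r - 1) * (e * r * D e / S)"
      using \<alpha> r by (intro mult_left_mono) auto
    moreover have "(\<integral>z. L z * u z \<partial>M) + \<alpha> / (r - 1) * ln S
        \<le> (\<integral>z. L z * w z \<partial>M) + \<alpha> / (r - 1) * ln (\<integral>z. w z powr r \<partial>M)"
      using min[OF wd] unfolding objective_eq[OF u L] objective_eq[OF wd wr wL L] S_def by simp
    ultimately have "0 \<le> e * I + \<alpha> / (r - 1) * (e * r * D e / S)"
      using Lw by (simp add: right_diff_distrib)
    also have "\<dots> = e * (I + \<alpha> * r / ((r - 1) * S) * D e)"
      by (simp add: algebra_simps)
    finally show ?thesis using e by (simp add: zero_le_mult_iff)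
  qed
  \<comment> \<open>The values \<open>1 / Suc n\<close> lie in the range that \<open>step\<close>
    admits, and \<open>powr_mix_diff_le\<close> supplies the domination.\<close>
  have "(\<lambda>n. D (1 / real (Suc n))) \<longlonglongrightarrow> (\<integral>z. u z powr (r - 1) * (v z - u z) \<partial>M)"
    unfolding D_def
  proof (rule integral_dominated_convergence[OF _ _ intuv])
    have lim: "(\<lambda>n. 1 / real (Suc n)) \<longlonglongrightarrow> 0"
      using LIMSEQ_inverse_real_of_nat by (simp add: inverse_eq_divide)
    have "(\<lambda>n. ((1 - 1 / real (Suc n)) * u z + 1 / real (Suc n) * v z) powr (r - 1) * (v z - u z))
        \<longlonglongrightarrow> ((1 - 0) * u z + 0 * v z) powr (r - 1) * (v z - u z)" if z: "z \<in> space M" for z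
    proof -
      have "(\<lambda>n. (1 - 1 / real (Suc n)) * u z + 1 / real (Suc n) * v z)
          \<longlonglongrightarrow> (1 - 0) * u z + 0 * v z"
        by (intro tendsto_add tendsto_mult tendsto_diff tendsto_const lim)
      \<comment> \<open>The base may tend to 0; continuity of \<open>powr\<close> there needs
        nonnegative bases and the positive exponent \<open>r - 1\<close>.\<close>
      moreover have "0 \<le> (1 - 1 / real (Suc n)) * u z + 1 / real (Suc n) * v z" for n
        using nonneg[OF z] by (intro add_nonneg_nonneg mult_nonneg_nonneg) auto
      ultimately show ?thesis
        using nonneg[OF z] r
        by (intro tendsto_mult[OF tendsto_powr'[OF _ tendsto_const] tendsto_const])
          (auto intro: always_eventually)
    qed
    then show "AE z in M. (\<lambda>n. ((1 - 1 / real (Suc n)) * u z + 1 / real (Suc n) * v z) powr (r - 1)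
        * (v z - u z)) \<longlonglongrightarrow> u z powr (r - 1) * (v z - u z)"
      unfolding diff_zero mult_1_left mult_zero_left add_0_right by (rule AE_I2)
    show "AE z in M. norm (((1 - 1 / real (Suc n)) * u z + 1 / real (Suc n) * v z) powr (r - 1)
        * (v z - u z)) \<le> u z powr r + v z powr r" for n
      unfolding real_norm_def
      by (intro AE_I2 powr_mix_diff_le nonneg) (use r in auto)
  qed measurable
  then have lim: "(\<lambda>n. I + \<alpha> * r / ((r - 1) * S) * D (1 / real (Suc n)))
      \<longlonglongrightarrow> I + \<alpha> * r / ((r - 1) * S) * (\<integral>z. u z powr (r - 1) * (v z - u z) \<partial>M)"
    by (intro tendsto_add tendsto_mult tendsto_const)
  have "0 \<le> I + \<alpha> * r / ((r - 1) * S) * D (1 / real (Suc n))" for n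
    by (rule step) auto
  then show ?thesis
    unfolding S_def[symmetric] I_def[symmetric] by (intro LIMSEQ_le_const[OF lim]) blast
qed

section \<open>Integrability of the loss and of its product with the density\<close>

lemma integrable_ext_L1:
  assumes "ext_L1 M l"
  shows "integrable M (\<lambda>z. real_of_ereal (l z))" "AE z in M. l z = ereal (real_of_ereal (l z))"
proof -
  have [measurable]: "l \<in> borel_measurable M" and fin: "(\<integral>\<^sup>+ z. e2ennreal \<bar>l z\<bar> \<partial>M) < \<infinity>"
    using assms by (auto simp: ext_L1_def)
  have "AE z in M. e2ennreal \<bar>l z\<bar> \<noteq> \<infinity>"
    using fin by (intro nn_integral_PInf_AE) (auto simp: less_top)
  then show eq: "AE z in M. l z = ereal (real_of_ereal (l z))"
  proof eventually_elim
    case (elim z)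
    then show ?case by (cases "l z") auto
  qed
  have "(\<integral>\<^sup>+ z. ennreal (norm (real_of_ereal (l z))) \<partial>M) = (\<integral>\<^sup>+ z. e2ennreal \<bar>l z\<bar> \<partial>M)"
    using eq
  proof (intro nn_integral_cong_AE, eventually_elim)
    case (elim z)
    then show ?case by (cases "l z") auto
  qed
  with fin show "integrable M (\<lambda>z. real_of_ereal (l z))"
    by (intro integrableI_bounded) auto
qed

text \<open>The lower bound \<open>c\<close> keeps the negative part of \<open>L z * u z\<close>
  below \<open>\<bar>c\<bar> * u z\<close>, which is integrable. The logarithmic term is a real
  number, so an infinite positive part would make the objective infinite.\<close>

lemma integrable_of_objective_finite:
  assumes u: "density_fun M u" "integrable M (\<lambda>z. u z powr r)"
    and L: "L \<in> borel_measurable M" "AE z in M. l z = ereal (L z)" "AE z in M. c \<le> L z"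
    and fin: "objective M \<alpha> r l u < \<infinity>"
  shows "integrable M (\<lambda>z. L z * u z)"
proof -
  note [measurable] = L(1)
  have [measurable]: "u \<in> borel_measurable M" and u0: "AE z in M. 0 \<le> u z"
    using u(1) by (auto simp: density_fun_def)
  have "(\<integral>\<^sup>+ z. ennreal (- (L z * u z)) \<partial>M) \<le> (\<integral>\<^sup>+ z. ennreal (\<bar>c\<bar> * u z) \<partial>M)"
    using u0 L(3)
  proof (intro nn_integral_mono_AE, eventually_elim)
    case (elim z)
    have "(- L z) * u z \<le> \<bar>c\<bar> * u z" using elim by (intro mult_right_mono) auto
    then show ?case by (intro ennreal_leI) simp
  qed
  also have "\<dots> = ennreal (\<integral>z. \<bar>c\<bar> * u z \<partial>M)"
    using density_fun_integral[OF u(1)] u0 by (intro nn_integral_eq_integral) auto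
  finally have neg: "(\<integral>\<^sup>+ z. ennreal (- (L z * u z)) \<partial>M) < \<infinity>"
    by (simp add: order_le_less_trans)
  have p: "(\<integral>\<^sup>+ z. e2ennreal (l z * ereal (u z)) \<partial>M) = (\<integral>\<^sup>+ z. ennreal (L z * u z) \<partial>M)"
    using L(2) by (intro nn_integral_cong_AE) auto
  have q: "(\<integral>\<^sup>+ z. e2ennreal (- (l z * ereal (u z))) \<partial>M) = (\<integral>\<^sup>+ z. ennreal (- (L z * u z)) \<partial>M)"
    using L(2) by (intro nn_integral_cong_AE) auto
  have "(\<integral>\<^sup>+ z. ennreal (u z powr r) \<partial>M) = ennreal (\<integral>z. u z powr r \<partial>M)"
    using u(2) by (intro nn_integral_eq_integral) auto
  then have log: "ext_log (\<integral>\<^sup>+ z. ennreal (u z powr r) \<partial>M) = ereal (ln (\<integral>z. u z powr r \<partial>M))"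
    using density_fun_powr_integral_pos[OF u] by (simp add: ext_log_def)
  have "(\<integral>\<^sup>+ z. ennreal (L z * u z) \<partial>M) \<noteq> \<infinity>"
  proof
    assume "(\<integral>\<^sup>+ z. ennreal (L z * u z) \<partial>M) = \<infinity>"
    then have "ext_integral M (\<lambda>z. l z * ereal (u z)) = \<infinity>"
      using neg unfolding ext_integral_def p q
      by (cases "\<integral>\<^sup>+ z. ennreal (- (L z * u z)) \<partial>M") auto
    then show False using fin log by (simp add: objective_def)
  qed
  with neg show ?thesis
    by (subst real_integrable_def) auto
qed

section \<open>Pointwise optimality conditions\<close>

lemma density_fun_indicator:
  assumes "B \<in> sets M" "0 < measure M B" "emeasure M B < \<infinity>"
  shows "density_fun M (\<lambda>z. indicator B z / measure M B)"
  using assms by (intro density_funI) auto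

text \<open>Stationarity and complementary slackness in one identity: \<open>lam\<close> is the
  multiplier of the mass constraint, and the maximum with 0 accounts for the points where
  \<open>u\<close> vanishes.\<close>

lemma (in prob_space) minimizer_optimality:
  assumes r: "1 < r" and \<alpha>: "0 < \<alpha>"
    and u: "density_fun M u" "integrable M (\<lambda>z. u z powr r)" "integrable M (\<lambda>z. L z * u z)"
    and Li: "integrable M L"
    and L: "AE z in M. l z = ereal (L z)"
    and min: "\<And>w. density_fun M w \<Longrightarrow> objective M \<alpha> r l u \<le> objective M \<alpha> r l w"
  defines "k \<equiv> \<alpha> * r / ((r - 1) * (\<integral>z. u z powr r \<partial>M))"
  obtains lam where "AE z in M. k * u z powr (r - 1) = max 0 (lam - L z)"
proof -
  have [measurable]: "u \<in> borel_measurable M" and u0: "\<And>z. z \<in> space M \<Longrightarrow> 0 \<le> u z"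
    using u(1) by (auto simp: density_fun_def)
  note [measurable] = borel_measurable_integrable[OF Li]
  have k: "0 < k"
    using density_fun_powr_integral_pos[OF u(1,2)] r \<alpha> by (auto simp: k_def)
  define w where "w z = L z + k * u z powr (r - 1)" for z
  have upow: "integrable M (\<lambda>z. u z powr (r - 1))"
  proof (rule Bochner_Integration.integrable_bound)
    show "integrable M (\<lambda>z. 1 + u z powr r)" using u by simp
    \<comment> \<open>The lower power is at most 1 on the unit interval and at most
      \<open>x powr r\<close> beyond it; constants are integrable under a probability
      measure.\<close>
    have "x powr (r - 1) \<le> 1 + x powr r" if "0 \<le> x" for x :: real
    proof (cases "x \<le> 1")
      case True
      then have "x powr (r - 1) \<le> 1" using that r by (intro powr_le1) auto
      then show ?thesis by (simp add: add_increasing2)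
    next
      case False
      then have "x powr (r - 1) \<le> x powr r" by (intro powr_mono) auto
      then show ?thesis by simp
    qed
    then show "AE z in M. norm (u z powr (r - 1)) \<le> norm (1 + u z powr r)"
      using u0 by (intro AE_I2) (simp add: abs_of_nonneg add_nonneg_nonneg)
  qed measurable
  have wi: "integrable M w" unfolding w_def using upow Li by simp
  have upu: "u z powr (r - 1) * u z = u z powr r" if "z \<in> space M" for z
    using powr_mult_base[OF u0[OF that], of "r - 1"] by (simp add: mult.commute)
  have upui: "integrable M (\<lambda>z. u z powr (r - 1) * u z)"
    using u(2) upu by (subst Bochner_Integration.integrable_cong[OF refl]) auto
  have wui: "integrable M (\<lambda>z. w z * u z)"
    using u(3) integrable_mult_right[OF upui, of k] by (simp add: w_def distrib_right mult.assoc)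
  define lam where "lam = (\<integral>z. w z * u z \<partial>M)"
  define B where "B = {z \<in> space M. w z < lam}"
  have [measurable]: "w \<in> borel_measurable M" using wi by auto
  have B[measurable]: "B \<in> sets M" unfolding B_def by measurable
  have "measure M B = 0"
  proof (rule ccontr)
    assume "measure M B \<noteq> 0"
    then have PB: "0 < measure M B" by (simp add: zero_less_measure_iff)
    \<comment> \<open>The competitor puts all mass where \<open>w\<close> is below its
      \<open>u\<close>-average, so moving towards it would lower the objective to first
      order.\<close>
    define v where "v z = indicator B z / measure M B" for z
    have vd: "density_fun M v"
      unfolding v_def using PB by (intro density_fun_indicator) (auto simp: emeasure_eq_measure)
    have indint: "integrable M (\<lambda>z. f z * indicator B z)" if "integrable M f" for f :: "'a \<Rightarrow> real"
      using that B by (rule integrable_real_mult_indicator[rotated])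
    have fv: "integrable M (\<lambda>z. f z * v z)" if "integrable M f" for f :: "'a \<Rightarrow> real"
      using indint[OF that] by (simp add: v_def)
    have "v z powr r = indicator B z * (1 / measure M B) powr r" for z
      by (simp add: v_def indicator_def)
    then have vr: "integrable M (\<lambda>z. v z powr r)" by (simp add: emeasure_eq_measure)
    have "0 \<le> (\<integral>z. L z * (v z - u z) \<partial>M) + k * (\<integral>z. u z powr (r - 1) * (v z - u z) \<partial>M)"
      unfolding k_def by (rule first_order_condition[OF r \<alpha> u vd vr fv[OF Li] L min])
    also have "\<dots> = (\<integral>z. w z * v z \<partial>M) - lam"
      using u(3) fv[OF Li] fv[OF upow] upui
      by (simp add: lam_def w_def right_diff_distrib distrib_right mult.assoc)
    finally have "lam \<le> (\<integral>z. w z * v z \<partial>M)" by simp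
    moreover have "(\<integral>z. lam * v z \<partial>M) = lam" using density_fun_integral[OF vd] by simp
    moreover have lv: "integrable M (\<lambda>z. lam * v z)" using density_fun_integral[OF vd] by simp
    ultimately have le: "(\<integral>z. lam * v z - w z * v z \<partial>M) \<le> 0"
      unfolding Bochner_Integration.integral_diff[OF lv fv[OF wi]] by linarith
    \<comment> \<open>The integrand is strictly positive on \<open>B\<close> and 0 elsewhere, so an
      integral that is at most 0 forces \<open>B\<close> to be null.\<close>
    have nn: "AE z in M. 0 \<le> lam * v z - w z * v z"
      using PB by (intro AE_I2) (auto simp: v_def B_def indicator_def divide_right_mono)
    have "(\<integral>z. lam * v z - w z * v z \<partial>M) = 0"
      using le integral_nonneg_AE[OF nn] by simp
    then have "AE z in M. lam * v z - w z * v z = 0"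
      using integral_nonneg_eq_0_iff_AE[OF _ nn] lv fv[OF wi] by simp
    then have "AE z in M. z \<notin> B"
      by eventually_elim (use PB in \<open>auto simp: v_def B_def\<close>)
    then have "measure M B = 0" using B by (simp add: AE_iff_measurable prob_eq_0)
    with PB show False by simp
  qed
  then have "AE z in M. z \<notin> B" using B by (simp add: prob_eq_0)
  then have ge: "AE z in M. lam \<le> w z"
    using AE_space by eventually_elim (auto simp: B_def)
  have nn: "AE z in M. 0 \<le> w z * u z - lam * u z"
    using ge AE_space by eventually_elim (auto simp: u0 mult_right_mono)
  \<comment> \<open>By the definition of \<open>lam\<close> and the unit mass of \<open>u\<close>. A
    nonnegative integrand with integral 0 vanishes almost everywhere, so \<open>w\<close> equals
    \<open>lam\<close> where \<open>u\<close> is nonzero.\<close>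
  have "(\<integral>z. w z * u z - lam * u z \<partial>M) = 0"
    using wui density_fun_integral[OF u(1)] by (simp add: lam_def)
  then have "AE z in M. w z * u z - lam * u z = 0"
    using integral_nonneg_eq_0_iff_AE[OF _ nn] wui density_fun_integral[OF u(1)] by simp
  then have "AE z in M. k * u z powr (r - 1) = max 0 (lam - L z)"
    using ge AE_space
  proof eventually_elim
    case (elim z)
    show ?case
    proof (cases "u z = 0")
      \<comment> \<open>Since \<open>0 powr (r - 1)\<close> is 0, here \<open>w z\<close> is
        \<open>L z\<close>; then \<open>lam \<le> L z\<close> and both sides are 0.\<close>
      case True
      then show ?thesis using elim by (simp add: w_def)
    next
      case False
      then have "w z = lam" using elim by auto
      moreover have "0 \<le> k * u z powr (r - 1)" using k by simp
      ultimately show ?thesis by (simp add: w_def max_def)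
    qed
  qed
  then show thesis by (rule that)
qed

section \<open>Normalization and the equation for the multiplier\<close>

theorem theorem7:
  fixes P Q :: "'a measure" and l :: "'a \<Rightarrow> ereal" and u :: "'a \<Rightarrow> real"
    and \<alpha> r s :: real
  assumes "prob_space P"
    and "0 < \<alpha>" and "1 < r"
    and "s = 1 / (r - 1)"
    and "\<forall>z\<in>space P. l z \<noteq> -\<infinity>"
    and "ext_L1 P l"
    and "\<exists>c::real. AE z in P. ereal c \<le> l z"
    and "is_arg_min (objective P \<alpha> r l) (density_fun P) u"
    and "Q = density P (\<lambda>z. ennreal (u z))"
    and "0 < (\<integral>\<^sup>+ z. ennreal (u z powr r) \<partial>P)"
    and "(\<integral>\<^sup>+ z. ennreal (u z powr r) \<partial>P) < \<infinity>"
  shows "\<exists>lam::real. ess_inf P l < ereal lam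
    \<and> (AE z in P. RN_deriv P Q z = ennreal (u z)
           \<and> u z = pos_gap l lam z powr s / A_fun P l s lam)
    \<and> \<alpha> = (r - 1) / r * (A_fun P l (s + 1) lam / A_fun P l s lam)"
proof -
  interpret prob_space P by fact
  define L where "L z = real_of_ereal (l z)" for z
  have Li: "integrable P L" and L: "AE z in P. l z = ereal (L z)"
    using integrable_ext_L1[OF assms(6)] unfolding L_def[abs_def] by auto
  have [measurable]: "l \<in> borel_measurable P" using assms(6) by (simp add: ext_L1_def)
  obtain c where "AE z in P. ereal c \<le> l z" using assms(7) by blast
  with L have c: "AE z in P. c \<le> L z" by eventually_elim auto
  have ud: "density_fun P u"
    and min: "\<And>w. density_fun P w \<Longrightarrow> objective P \<alpha> r l u \<le> objective P \<alpha> r l w"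
    using assms(8) by (auto simp: is_arg_min_def not_less)
  have [measurable]: "u \<in> borel_measurable P" and u0: "\<And>z. z \<in> space P \<Longrightarrow> 0 \<le> u z"
    using ud by (auto simp: density_fun_def)
  have ur: "integrable P (\<lambda>z. u z powr r)"
    using assms(11) by (intro integrableI_bounded) auto
  \<comment> \<open>The constant density has objective value \<open>integral\<^sup>L P L\<close>, as
    \<open>ln 1 = 0\<close>. This is finite, hence so is the minimal value.\<close>
  have one: "density_fun P (\<lambda>z. 1)"
    by (intro density_funI) (auto simp: prob_space)
  have "objective P \<alpha> r l u \<le> objective P \<alpha> r l (\<lambda>z. 1)" by (rule min[OF one])
  also have "\<dots> < \<infinity>" using Li by (subst objective_eq[OF one _ _ L]) auto
  finally have uL: "integrable P (\<lambda>z. L z * u z)"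
    using Li by (intro integrable_of_objective_finite[OF ud ur _ L c]) auto
  define S where "S = (\<integral>z. u z powr r \<partial>P)"
  have S: "0 < S" unfolding S_def by (rule density_fun_powr_integral_pos[OF ud ur])
  define k where "k = \<alpha> * r / ((r - 1) * S)"
  have k: "0 < k" using S assms(2,3) by (simp add: k_def)
  obtain lam where "AE z in P. k * u z powr (r - 1) = max 0 (lam - L z)"
    using minimizer_optimality[OF assms(3,2) ud ur uL Li L min] unfolding k_def S_def by blast
  with L have gap: "AE z in P. pos_gap l lam z = k * u z powr (r - 1)"
    by eventually_elim (simp add: pos_gap_def max_def)
  have [measurable]: "(\<lambda>z. pos_gap l lam z) \<in> borel_measurable P"
    unfolding pos_gap_def by measurable
  \<comment> \<open>These identities turn the powers \<open>s\<close> and \<open>s + 1\<close> of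
    \<open>u z powr (r - 1)\<close> into \<open>u z\<close> and \<open>u z powr r\<close>, whose
    integrals are 1 and \<open>S\<close>.\<close>
  have s: "0 < s" "(r - 1) * s = 1" "(r - 1) * (s + 1) = r"
    using assms(3) by (auto simp: assms(4) field_simps)
  have gs: "AE z in P. pos_gap l lam z powr s = k powr s * u z"
    using gap AE_space by eventually_elim (use k s u0 in \<open>simp add: powr_mult powr_powr\<close>)
  have gs1: "AE z in P. pos_gap l lam z powr (s + 1) = k powr (s + 1) * u z powr r"
    using gap AE_space by eventually_elim (use k s u0 in \<open>simp add: powr_mult powr_powr\<close>)
  have As: "A_fun P l s lam = k powr s"
  proof -
    have "A_fun P l s lam = (\<integral>z. k powr s * u z \<partial>P)"
      unfolding A_fun_def using gs by (intro integral_cong_AE) auto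
    then show ?thesis using density_fun_integral[OF ud] by simp
  qed
  have As1: "A_fun P l (s + 1) lam = k powr (s + 1) * S"
  proof -
    have "A_fun P l (s + 1) lam = (\<integral>z. k powr (s + 1) * u z powr r \<partial>P)"
      unfolding A_fun_def using gs1 by (intro integral_cong_AE) auto
    then show ?thesis by (simp add: S_def)
  qed
  \<comment> \<open>Otherwise the gap, and with it \<open>u\<close>, would vanish almost everywhere,
    against the unit mass of \<open>u\<close>.\<close>
  have "ess_inf P l < ereal lam"
  proof (rule ccontr)
    assume "\<not> ess_inf P l < ereal lam"
    then have "esssup P (\<lambda>z. - l z) \<le> - ereal lam"
      unfolding ess_inf_def not_less by (metis ereal_minus_le_minus ereal_uminus_uminus)
    moreover have "AE z in P. - l z \<le> esssup P (\<lambda>z. - l z)" by (rule esssup_AE)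
    ultimately have "AE z in P. - l z \<le> - ereal lam" by (auto elim: eventually_mono)
    then have "AE z in P. u z = 0"
      using L gap
    proof eventually_elim
      case (elim z)
      then have "pos_gap l lam z = 0" by (simp add: pos_gap_def)
      then show ?case using elim k by simp
    qed
    then have "integral\<^sup>L P u = 0" by (rule integral_eq_zero_AE)
    then show False using density_fun_integral[OF ud] by simp
  qed
  moreover have "AE z in P. ennreal (u z) = RN_deriv P Q z"
    by (rule RN_deriv_unique) (use assms(9) in auto)
  then have "AE z in P. RN_deriv P Q z = ennreal (u z)
      \<and> u z = pos_gap l lam z powr s / A_fun P l s lam"
    using gs by eventually_elim (use k As in auto)
  moreover have "\<alpha> = (r - 1) / r * (A_fun P l (s + 1) lam / A_fun P l s lam)"
  proof -
    \<comment> \<open>The factor \<open>S\<close> cancels the one in the denominator of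
      \<open>k\<close>, leaving \<open>\<alpha> * r / (r - 1)\<close>.\<close>
    have "A_fun P l (s + 1) lam / A_fun P l s lam = k * S"
      using k by (simp add: As As1 powr_add)
    then show ?thesis using S assms(3) by (simp add: k_def)
  qed
  ultimately show ?thesis by blast
qed

end
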